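(* Let $b_1>1$ and $c>0$, and let $Tf$ be the surface generated by the Hugoniot curves through points of the fold curve. The surface $Tf$ is tangent to the characteristic surface $\mathcal C$ and to the sonic' surface $Son'$.
   Context: Setting. Let $F=(f,g):\mathbb R^2\to\mathbb R^2$ with $f(u,v)=\frac{v^2}{2}+(b_1+1)\frac{u^2}{2}+a_1u+a_2v$ and $g(u,v)=uv+a_3u+a_4v$, where $a_1,\dots,a_4$ are real constants, $b_1>1$ and $c:=a_3-a_2>0$. For $W=(u,v)$, $W'=(u',v')$ put $U=\frac{u+u'}2$, $V=\frac{v+v'}2$, $X=u-u'$, $Y=v-v'$, $\tilde U=b_1U+a_1-a_4$, $\tilde V=V+a_2$, $V_1=V+a_3=\tilde V+c$. Wave manifold. $M$ is the 3-manifold obtained by blowing up $\{(W,W',s): F(W)-F(W')=s(W-W')\}$ along the diagonal $W=W'$: it is the set of $(U,V,X,Y)$ together with a direction $Z\in\mathbb{RP}^1$ such that $Y=ZX$ and $(1-Z^2)\tilde V-Z\tilde U+c=0$ (suitably homogenized at $Z=\infty$). $\Pi\subset M$ is the plane $Z=0$. On $M\setminus\Pi$ put $z=1/Z$, so $X=zY$ and the equation of $M$ becomes $(z^2-1)V_1-z\tilde U+c=0$. Global coordinates $(t,z,Y)\in\mathbb R^3$ on $M\setminus\Pi$ are given by $$\tilde U=\frac{2cz}{z^2+1}+ct(z^2-1),\qquad V_1=\frac{c}{z^2+1}+ctz ,$$ and all surfaces below are considered in $M\setminus\Pi$. The speed $s$ on $M\setminus\Pi$ is $s=U+a_4+zV_1$.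 A Hugoniot curve is a set $\{u=\text{const},\,v=\text{const}\}$ in $M$, equivalently $2\tilde U+b_1X=k$, $2\tilde V+Y=l$ for constants $k,l$. A Hugoniot' curve is a set $\{u'=\text{const},\,v'=\text{const}\}$. The characteristic surface is $\mathcal C=\{X=Y=0\}$, i.e. $Y=0$ in coordinates $(t,z,Y)$. The fold curve (coincidence curve) is the circle in $\mathcal C$ of points $p$ such that the Hugoniot curve through $p$ meets $\mathcal C$ only at $p$; in $M\setminus\Pi$ it is $\{Y=0,t=0\}$, and it has one further point in $\Pi$ (the limit $z\to\infty$). The Hugoniot curves through points of the fold curve are those whose constants $(k,l)$ lie on the ellipse $k^2+4l^2+8cl=0$; their union (in $M\setminus\Pi$) is $Tf$. The sonic' surface $Son'$ is the set of critical points of $s$ restricted to Hugoniot' curves; in coordinates $(t,z,Y)$ it is $$-2c\big((b_1+1)z^5+(b_1+4)z^3+3z\big)t+\big((b_1+1)z^4+b_1z^2-1\big)Y-2c\big((b_1-1)z^2+1\big)=0.$$ Two surfaces are called tangent if they intersect and, at the points of their intersection, their tangent planes coincide. *)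

theory Defs
  imports "HOL-Analysis.Analysis"
begin

text \<open>
  The parameters \<open>a1 a2 a3 a4 b1\<close> are explicit arguments throughout, and \<open>c\<close> is \<open>a3 - a2\<close>.
  A state \<open>W = (u, v)\<close> is a pair of reals.
\<close>

definition flux :: "real \<Rightarrow> real \<Rightarrow> real \<Rightarrow> real \<Rightarrow> real \<Rightarrow> real \<times> real \<Rightarrow> real \<times> real" where
  "flux a1 a2 a3 a4 b1 = (\<lambda>(u, v).
     (v\<^sup>2 / 2 + (b1 + 1) * (u\<^sup>2 / 2) + a1 * u + a2 * v, u * v + a3 * u + a4 * v))"


section \<open>The wave manifold\<close>

text \<open>
  A point is \<open>(U, V, X, Y, L)\<close>, where the direction \<open>L\<close>, a point of the projective line, is
  a line through the origin of the plane; \<open>L = span {(p, q)}\<close> has \<open>Z = q / p\<close> and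
  \<open>z = 1 / Z = p / q\<close>.  So \<open>(X, Y) \<in> L\<close> is the homogeneous form of \<open>Y = Z X\<close>.
\<close>

type_synonym wave_point = "real \<times> real \<times> real \<times> real \<times> (real \<times> real) set"

definition wave_manifold ::
    "real \<Rightarrow> real \<Rightarrow> real \<Rightarrow> real \<Rightarrow> real \<Rightarrow> wave_point set" where
  "wave_manifold a1 a2 a3 a4 b1 = {(U, V, X, Y, L). \<exists>p q.
     (p, q) \<noteq> (0, 0) \<and> L = span {(p, q)} \<and> (X, Y) \<in> L \<and>
     (p\<^sup>2 - q\<^sup>2) * (V + a2) - p * q * (b1 * U + a1 - a4) + (a3 - a2) * p\<^sup>2 = 0}"

text \<open>The plane \<open>\<Pi>\<close>, i.e. \<open>Z = 0\<close>.\<close>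

definition wave_plane ::
    "real \<Rightarrow> real \<Rightarrow> real \<Rightarrow> real \<Rightarrow> real \<Rightarrow> wave_point set" where
  "wave_plane a1 a2 a3 a4 b1 =
     {(U, V, X, Y, L). (U, V, X, Y, L) \<in> wave_manifold a1 a2 a3 a4 b1 \<and> L = span {(1, 0)}}"

definition left_state :: "wave_point \<Rightarrow> real \<times> real" where
  "left_state = (\<lambda>(U, V, X, Y, L). (U + X / 2, V + Y / 2))"

definition right_state :: "wave_point \<Rightarrow> real \<times> real" where
  "right_state = (\<lambda>(U, V, X, Y, L). (U - X / 2, V - Y / 2))"

definition hugoniot ::
    "real \<Rightarrow> real \<Rightarrow> real \<Rightarrow> real \<Rightarrow> real \<Rightarrow> wave_point \<Rightarrow> wave_point set" where
  "hugoniot a1 a2 a3 a4 b1 m =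
     {m' \<in> wave_manifold a1 a2 a3 a4 b1. left_state m' = left_state m}"

definition hugoniot' ::
    "real \<Rightarrow> real \<Rightarrow> real \<Rightarrow> real \<Rightarrow> real \<Rightarrow> wave_point \<Rightarrow> wave_point set" where
  "hugoniot' a1 a2 a3 a4 b1 m =
     {m' \<in> wave_manifold a1 a2 a3 a4 b1. right_state m' = right_state m}"

definition characteristic ::
    "real \<Rightarrow> real \<Rightarrow> real \<Rightarrow> real \<Rightarrow> real \<Rightarrow> wave_point set" where
  "characteristic a1 a2 a3 a4 b1 =
     {(U, V, X, Y, L). (U, V, X, Y, L) \<in> wave_manifold a1 a2 a3 a4 b1 \<and> X = 0 \<and> Y = 0}"

text \<open>The fold curve lives in the whole wave manifold, so it includes its one point on \<open>\<Pi>\<close>.\<close>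

definition fold_curve ::
    "real \<Rightarrow> real \<Rightarrow> real \<Rightarrow> real \<Rightarrow> real \<Rightarrow> wave_point set" where
  "fold_curve a1 a2 a3 a4 b1 =
     {m \<in> characteristic a1 a2 a3 a4 b1.
        hugoniot a1 a2 a3 a4 b1 m \<inter> characteristic a1 a2 a3 a4 b1 = {m}}"


section \<open>Global coordinates off the plane\<close>

text \<open>
  With \<open>c = a3 - a2\<close>, the two values below are \<open>b1 U + a1 - a4 = 2cz/(z\<^sup>2+1) + ct(z\<^sup>2-1)\<close> and
  \<open>V + a3 = c/(z\<^sup>2+1) + ctz\<close>, solved for \<open>U\<close> and \<open>V\<close> (\<open>b1 \<noteq> 0\<close>).
\<close>

definition coord_U ::
    "real \<Rightarrow> real \<Rightarrow> real \<Rightarrow> real \<Rightarrow> real \<Rightarrow> real \<Rightarrow> real \<Rightarrow> real" where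
  "coord_U a1 a2 a3 a4 b1 t z =
     (2 * (a3 - a2) * z / (z\<^sup>2 + 1) + (a3 - a2) * t * (z\<^sup>2 - 1) - a1 + a4) / b1"

definition coord_V ::
    "real \<Rightarrow> real \<Rightarrow> real \<Rightarrow> real \<Rightarrow> real" where
  "coord_V a2 a3 t z = (a3 - a2) / (z\<^sup>2 + 1) + (a3 - a2) * t * z - a3"

definition chart ::
    "real \<Rightarrow> real \<Rightarrow> real \<Rightarrow> real \<Rightarrow> real \<Rightarrow> real \<times> real \<times> real \<Rightarrow> wave_point" where
  "chart a1 a2 a3 a4 b1 = (\<lambda>(t, z, Y).
     (coord_U a1 a2 a3 a4 b1 t z, coord_V a2 a3 t z, z * Y, Y, span {(z, 1)}))"

definition speed ::
    "real \<Rightarrow> real \<Rightarrow> real \<Rightarrow> real \<Rightarrow> real \<Rightarrow> real \<times> real \<times> real \<Rightarrow> real" where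
  "speed a1 a2 a3 a4 b1 = (\<lambda>(t, z, Y).
     coord_U a1 a2 a3 a4 b1 t z + a4 + z * (coord_V a2 a3 t z + a3))"


section \<open>The surfaces, in coordinates\<close>

definition char_surface ::
    "real \<Rightarrow> real \<Rightarrow> real \<Rightarrow> real \<Rightarrow> real \<Rightarrow> (real \<times> real \<times> real) set" where
  "char_surface a1 a2 a3 a4 b1 = chart a1 a2 a3 a4 b1 -` characteristic a1 a2 a3 a4 b1"

definition Tf ::
    "real \<Rightarrow> real \<Rightarrow> real \<Rightarrow> real \<Rightarrow> real \<Rightarrow> (real \<times> real \<times> real) set" where
  "Tf a1 a2 a3 a4 b1 =
     chart a1 a2 a3 a4 b1 -` (\<Union>m \<in> fold_curve a1 a2 a3 a4 b1. hugoniot a1 a2 a3 a4 b1 m)"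

text \<open>
  Critical point of \<open>h\<close> restricted to a curve \<open>K\<close>: the derivative of \<open>h\<close> along \<open>K\<close> vanishes,
  expressed through parametrized paths inside \<open>K\<close>.  The test is meaningful at points where \<open>K\<close>
  is a regular curve; off \<open>\<Pi>\<close>, a Hugoniot' curve is one everywhere (a graph over \<open>z\<close>).
\<close>

definition critical_point_on ::
    "('a::real_normed_vector \<Rightarrow> real) \<Rightarrow> 'a set \<Rightarrow> 'a \<Rightarrow> bool" where
  "critical_point_on h K p \<longleftrightarrow> p \<in> K \<and>
     (\<forall>\<gamma> v. \<gamma> 0 = p \<and> (\<forall>\<tau>::real. \<gamma> \<tau> \<in> K) \<and> (\<gamma> has_vector_derivative v) (at 0)
        \<longrightarrow> ((\<lambda>\<tau>. h (\<gamma> \<tau>)) has_real_derivative 0) (at 0))"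

definition Son' ::
    "real \<Rightarrow> real \<Rightarrow> real \<Rightarrow> real \<Rightarrow> real \<Rightarrow> (real \<times> real \<times> real) set" where
  "Son' a1 a2 a3 a4 b1 =
     {x. critical_point_on (speed a1 a2 a3 a4 b1)
           (chart a1 a2 a3 a4 b1 -` hugoniot' a1 a2 a3 a4 b1 (chart a1 a2 a3 a4 b1 x)) x}"


section \<open>Regular surfaces and tangency\<close>

text \<open>
  Near \<open>p\<close>, \<open>S\<close> is the zero set of a \<open>C\<^sup>1\<close> function without critical points, and \<open>P\<close> is
  the kernel of its derivative at \<open>p\<close>.  By \<open>has_tangent_plane_unique\<close>, \<open>P\<close> depends only on
  \<open>S\<close> and \<open>p\<close>.
\<close>

definition has_tangent_plane ::
    "(real \<times> real \<times> real) set \<Rightarrow> real \<times> real \<times> real \<Rightarrow> (real \<times> real \<times> real) set \<Rightarrow> bool" where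
  "has_tangent_plane S p P \<longleftrightarrow> p \<in> S \<and>
     (\<exists>N \<phi> g. open N \<and> p \<in> N \<and> (\<forall>x\<in>N. GDERIV \<phi> x :> g x) \<and> continuous_on N g \<and>
        (\<forall>x\<in>N. g x \<noteq> 0) \<and> S \<inter> N = {x \<in> N. \<phi> x = 0} \<and> P = {v. v \<bullet> g p = 0})"

definition regular_surface :: "(real \<times> real \<times> real) set \<Rightarrow> bool" where
  "regular_surface S \<longleftrightarrow> (\<forall>p\<in>S. \<exists>P. has_tangent_plane S p P)"

definition tangent_surfaces ::
    "(real \<times> real \<times> real) set \<Rightarrow> (real \<times> real \<times> real) set \<Rightarrow> bool" where
  "tangent_surfaces S T \<longleftrightarrow>
     regular_surface S \<and> regular_surface T \<and> S \<inter> T \<noteq> {} \<and>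
     (\<forall>p \<in> S \<inter> T. \<exists>P. has_tangent_plane S p P \<and> has_tangent_plane T p P)"


section \<open>Consistency of the definitions\<close>

lemma span_pair_iff: "(X, Y) \<in> span {(p::real, q::real)} \<longleftrightarrow> (\<exists>k. X = k * p \<and> Y = k * q)"
  by (auto simp: span_singleton)

text \<open>Off the diagonal, the wave manifold is the Rankine--Hugoniot set.\<close>

lemma wave_manifold_off_diagonal:
  assumes "(X, Y) \<noteq> (0, 0)"
  shows "(\<exists>L. (U, V, X, Y, L) \<in> wave_manifold a1 a2 a3 a4 b1) \<longleftrightarrow>
    (\<exists>s. flux a1 a2 a3 a4 b1 (U + X / 2, V + Y / 2) - flux a1 a2 a3 a4 b1 (U - X / 2, V - Y / 2)
           = s *\<^sub>R (X, Y))"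
proof -
  define E where "E p q = (p\<^sup>2 - q\<^sup>2) * (V + a2) - p * q * (b1 * U + a1 - a4) + (a3 - a2) * p\<^sup>2"
    for p q
  define A where "A = V * Y + (b1 + 1) * U * X + a1 * X + a2 * Y"
  define B where "B = U * Y + V * X + a3 * X + a4 * Y"
  have flux: "flux a1 a2 a3 a4 b1 (U + X / 2, V + Y / 2) - flux a1 a2 a3 a4 b1 (U - X / 2, V - Y / 2)
    = (A, B)"
    by (simp add: flux_def A_def B_def power2_eq_square field_simps)
  have AB: "E X Y = B * X - A * Y"
    unfolding E_def A_def B_def by (simp add: power2_eq_square algebra_simps)
  have hom: "E (k * p) (k * q) = k\<^sup>2 * E p q" for k p q
    unfolding E_def by (simp add: power2_eq_square algebra_simps)
  have "(\<exists>L. (U, V, X, Y, L) \<in> wave_manifold a1 a2 a3 a4 b1) \<longleftrightarrow>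
      (\<exists>p q. (p, q) \<noteq> (0, 0) \<and> (X, Y) \<in> span {(p, q)} \<and> E p q = 0)"
    by (auto simp: wave_manifold_def E_def)
  also have "\<dots> \<longleftrightarrow> E X Y = 0"
  proof
    assume "E X Y = 0"
    moreover have "(X, Y) \<in> span {(X, Y)}" by (simp add: span_base)
    ultimately show "\<exists>p q. (p, q) \<noteq> (0, 0) \<and> (X, Y) \<in> span {(p, q)} \<and> E p q = 0"
      using assms by blast
  qed (auto simp: span_pair_iff hom)
  also have "\<dots> \<longleftrightarrow> (\<exists>s. (A, B) = s *\<^sub>R (X, Y))"
  proof
    assume "E X Y = 0"
    then have *: "B * X = A * Y" using AB by simp
    show "\<exists>s. (A, B) = s *\<^sub>R (X, Y)"
    proof (cases "X = 0")
      case True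
      with assms * show ?thesis by (intro exI[of _ "B / Y"]) auto
    next
      case False
      with * show ?thesis by (intro exI[of _ "A / X"]) (auto simp: field_simps)
    qed
  qed (auto simp: AB)
  finally show ?thesis by (simp add: flux)
qed

lemma speed_rankine_hugoniot:
  assumes "b1 \<noteq> 0"
  shows "flux a1 a2 a3 a4 b1 (left_state (chart a1 a2 a3 a4 b1 (t, z, Y)))
       - flux a1 a2 a3 a4 b1 (right_state (chart a1 a2 a3 a4 b1 (t, z, Y)))
       = speed a1 a2 a3 a4 b1 (t, z, Y) *\<^sub>R (z * Y, Y)"
proof -
  define U where "U = coord_U a1 a2 a3 a4 b1 t z"
  define V where "V = coord_V a2 a3 t z"
  have pos: "z\<^sup>2 + 1 \<noteq> 0" by (metis add.commute power_one sum_power2_eq_zero_iff zero_neq_one)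
  have U: "b1 * U + a1 - a4 = 2 * (a3 - a2) * z / (z\<^sup>2 + 1) + (a3 - a2) * t * (z\<^sup>2 - 1)"
    using assms by (simp add: U_def coord_U_def)
  have V: "V + a3 = (a3 - a2) / (z\<^sup>2 + 1) + (a3 - a2) * t * z"
    by (simp add: V_def coord_V_def)
  have eq: "(z\<^sup>2 - 1) * (V + a3) - z * (b1 * U + a1 - a4) + (a3 - a2) = 0"
    unfolding U V using pos by (simp add: divide_simps) (simp add: power2_eq_square algebra_simps)
  have "V * Y + (b1 + 1) * U * (z * Y) + a1 * (z * Y) + a2 * Y
      - (U + a4 + z * (V + a3)) * (z * Y)
      = - Y * ((z\<^sup>2 - 1) * (V + a3) - z * (b1 * U + a1 - a4) + (a3 - a2))"
    by (simp add: power2_eq_square algebra_simps)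
  then have "V * Y + (b1 + 1) * U * (z * Y) + a1 * (z * Y) + a2 * Y
      = (U + a4 + z * (V + a3)) * (z * Y)"
    unfolding eq by simp
  then show ?thesis
    by (simp add: chart_def left_state_def right_state_def flux_def speed_def
        flip: U_def V_def) (simp add: power2_eq_square field_simps)
qed

lemma chart_bij_betw:
  assumes "b1 \<noteq> 0" "a3 - a2 \<noteq> 0"
  shows "bij_betw (chart a1 a2 a3 a4 b1) UNIV
           (wave_manifold a1 a2 a3 a4 b1 - wave_plane a1 a2 a3 a4 b1)"
proof -
  define c where "c = a3 - a2"
  have c: "c \<noteq> 0" using assms by (simp add: c_def)
  have pos: "z\<^sup>2 + 1 \<noteq> 0" for z :: real
    by (metis add.commute power_one sum_power2_eq_zero_iff zero_neq_one)
  have lines: "z = z'" if "span {(z, 1::real)} = span {(z', 1::real)}" for z z' :: real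
  proof -
    have "(z, 1) \<in> span {(z', 1::real)}" using that by (metis insertI1 span_base)
    then show ?thesis by (auto simp: span_pair_iff)
  qed
  have inj: "inj (chart a1 a2 a3 a4 b1)"
  proof (rule injI)
    fix x x'
    assume "chart a1 a2 a3 a4 b1 x = chart a1 a2 a3 a4 b1 x'"
    moreover obtain t z Y t' z' Y' where x: "x = (t, z, Y)" "x' = (t', z', Y')"
      by (cases x, cases x') auto
    ultimately have eq: "chart a1 a2 a3 a4 b1 (t, z, Y) = chart a1 a2 a3 a4 b1 (t', z', Y')"
      by simp
    then have z: "z' = z" and Y: "Y' = Y" using lines by (auto simp: chart_def)
    have "coord_U a1 a2 a3 a4 b1 t z = coord_U a1 a2 a3 a4 b1 t' z"
      using eq z by (simp add: chart_def)
    then have 1: "c * t * (z\<^sup>2 - 1) = c * t' * (z\<^sup>2 - 1)"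
      using assms(1) unfolding coord_U_def c_def by simp
    have "coord_V a2 a3 t z = coord_V a2 a3 t' z"
      using eq z by (simp add: chart_def)
    then have 2: "c * t * z = c * t' * z"
      unfolding coord_V_def c_def by simp
    from 1 2 c have "t = t'" by (cases "z = 0") auto
    then show "x = x'" using x z Y by simp
  qed
  have into: "chart a1 a2 a3 a4 b1 (t, z, Y)
      \<in> wave_manifold a1 a2 a3 a4 b1 - wave_plane a1 a2 a3 a4 b1" for t z Y
  proof -
    define U where "U = coord_U a1 a2 a3 a4 b1 t z"
    define V where "V = coord_V a2 a3 t z"
    have U: "b1 * U + a1 - a4 = 2 * c * z / (z\<^sup>2 + 1) + c * t * (z\<^sup>2 - 1)"
      using assms by (simp add: U_def coord_U_def c_def)
    have V: "V + a2 = c / (z\<^sup>2 + 1) + c * t * z - c"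
      by (simp add: V_def coord_V_def c_def)
    have eq: "(z\<^sup>2 - 1) * (V + a2) - z * (b1 * U + a1 - a4) + c * z\<^sup>2 = 0"
      unfolding U V using pos[of z]
      by (simp add: divide_simps) (simp add: power2_eq_square algebra_simps)
    have "(z, 1) \<notin> span {(1::real, 0::real)}" by (simp add: span_pair_iff)
    then have ne: "span {(z, 1)} \<noteq> span {(1::real, 0::real)}" by (metis insertI1 span_base)
    have "\<exists>p q. (p, q) \<noteq> (0, 0) \<and> span {(z, 1)} = span {(p, q)} \<and> (z * Y, Y) \<in> span {(z, 1)} \<and>
       (p\<^sup>2 - q\<^sup>2) * (V + a2) - p * q * (b1 * U + a1 - a4) + (a3 - a2) * p\<^sup>2 = 0"
      using eq by (intro exI[of _ z] exI[of _ 1]) (auto simp: span_pair_iff c_def)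
    then show ?thesis
      using ne by (simp add: chart_def wave_manifold_def wave_plane_def flip: U_def V_def)
  qed
  have onto: "m \<in> range (chart a1 a2 a3 a4 b1)"
    if m_in: "m \<in> wave_manifold a1 a2 a3 a4 b1 - wave_plane a1 a2 a3 a4 b1" for m
  proof -
    obtain U V X Y L where m: "m = (U, V, X, Y, L)" by (cases m) auto
    have "m \<in> wave_manifold a1 a2 a3 a4 b1" using m_in by simp
    then obtain p q where pq: "(p, q) \<noteq> (0, 0)" "L = span {(p, q)}" "(X, Y) \<in> L"
      and eq: "(p\<^sup>2 - q\<^sup>2) * (V + a2) - p * q * (b1 * U + a1 - a4) + c * p\<^sup>2 = 0"
      unfolding m wave_manifold_def by (auto simp: c_def)
    have L: "L \<noteq> span {(1, 0)}" using m_in by (auto simp: m wave_plane_def)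
    have q: "q \<noteq> 0"
    proof
      assume "q = 0"
      with pq have "p \<noteq> 0" by simp
      have "span {(p, 0::real)} = span {(1, 0)}"
      proof (rule set_eqI)
        fix x :: "real \<times> real"
        obtain k l where "x = (k, l)" by (cases x)
        then show "x \<in> span {(p, 0::real)} \<longleftrightarrow> x \<in> span {(1, 0)}"
          using \<open>p \<noteq> 0\<close> by (auto simp: span_pair_iff intro: exI[of _ "k / p"])
      qed
      with L pq \<open>q = 0\<close> show False by simp
    qed
    define z where "z = p / q"
    have p: "p = z * q" using q by (simp add: z_def)
    have Lz: "L = span {(z, 1)}"
    proof (rule set_eqI)
      fix x :: "real \<times> real"
      obtain k l where "x = (k, l)" by (cases x)
      then show "x \<in> L \<longleftrightarrow> x \<in> span {(z, 1)}"
        using q unfolding pq(2) p by (auto simp: span_pair_iff intro: exI[of _ "l / q"])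
    qed
    have X: "X = z * Y" using pq(3) unfolding Lz by (auto simp: span_pair_iff)
    have "q\<^sup>2 * ((z\<^sup>2 - 1) * (V + a3) - z * (b1 * U + a1 - a4) + c) = 0"
      using eq unfolding p c_def by (simp add: power2_eq_square algebra_simps)
    then have eqz: "(z\<^sup>2 - 1) * (V + a3) - z * (b1 * U + a1 - a4) + c = 0"
      using q by simp
    define u where "u = b1 * U + a1 - a4 - 2 * c * z / (z\<^sup>2 + 1)"
    define v where "v = V + a3 - c / (z\<^sup>2 + 1)"
    have uv: "(z\<^sup>2 - 1) * v = z * u"
    proof -
      have "(z\<^sup>2 - 1) * v - z * u = (z\<^sup>2 - 1) * (V + a3) - z * (b1 * U + a1 - a4) + c"
        unfolding u_def v_def using pos[of z]
        by (simp add: divide_simps) (simp add: power2_eq_square algebra_simps)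
      then show ?thesis using eqz by simp
    qed
    obtain t where t: "u = c * t * (z\<^sup>2 - 1)" "v = c * t * z"
    proof (cases "z = 0")
      case True
      with uv have "v = 0" by simp
      with True c show ?thesis by (intro that[of "- u / c"]) auto
    next
      case False
      have "u = v / z * (z\<^sup>2 - 1)" using uv False by (simp add: field_simps)
      with False c show ?thesis by (intro that[of "v / (c * z)"]) auto
    qed
    have "U = coord_U a1 a2 a3 a4 b1 t z"
      using t(1) assms(1) by (simp add: u_def coord_U_def field_simps flip: c_def)
    moreover have "V = coord_V a2 a3 t z"
      using t(2) by (simp add: v_def coord_V_def flip: c_def)
    ultimately have "m = chart a1 a2 a3 a4 b1 (t, z, Y)"
      by (simp add: m chart_def X Lz)
    then show ?thesis by blast
  qed
  show ?thesis
    unfolding bij_betw_def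
  proof (intro conjI inj equalityI subsetI)
    fix m assume "m \<in> range (chart a1 a2 a3 a4 b1)"
    then obtain t z Y where "m = chart a1 a2 a3 a4 b1 (t, z, Y)" by auto
    then show "m \<in> wave_manifold a1 a2 a3 a4 b1 - wave_plane a1 a2 a3 a4 b1"
      using into by simp
  qed (rule onto)
qed

lemma has_tangent_plane_unique:
  assumes "has_tangent_plane S p P" "has_tangent_plane S p Q"
  shows "P = Q"
proof -
  have sub: "v \<bullet> n' = 0"
    if S: "open N" "p \<in> N" "\<forall>x\<in>N. GDERIV \<phi> x :> g x" "g p \<noteq> 0" "S \<inter> N = {x \<in> N. \<phi> x = 0}"
       "open N'" "p \<in> N'" "GDERIV \<phi>' p :> n'" "S \<inter> N' = {x \<in> N'. \<phi>' x = 0}"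
    and pS: "p \<in> S" and v: "v \<bullet> g p = 0"
    for N N' \<phi> \<phi>' g and n' v :: "real \<times> real \<times> real"
  proof (rule ccontr)
    define m where "m = v \<bullet> n'"
    define n where "n = g p"
    assume "v \<bullet> n' \<noteq> 0"
    then have m: "\<bar>m\<bar> > 0" by (simp add: m_def)
    define e where "e = \<bar>m\<bar> / (2 * (\<bar>n \<bullet> n'\<bar> + 1))"
    have e: "e > 0" using m by (simp add: e_def add_pos_nonneg)
    have em: "e * \<bar>n \<bullet> n'\<bar> \<le> \<bar>m\<bar> / 2"
      using m unfolding e_def by (simp add: divide_simps)
    define R where "R = norm v + e * norm n + 1"
    have R: "R > 0" using e by (simp add: R_def add_nonneg_pos)
    have der: "((\<lambda>\<tau>. \<phi> (p + \<tau> *\<^sub>R w)) has_real_derivative w \<bullet> n) (at 0)" for w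
    proof -
      have "(\<phi> has_derivative (\<lambda>h. h \<bullet> n)) (at (p + 0 *\<^sub>R w))"
        using S by (auto simp: gderiv_def n_def)
      then have "((\<lambda>\<tau>. \<phi> (p + \<tau> *\<^sub>R w)) has_derivative (\<lambda>h. (h *\<^sub>R w) \<bullet> n)) (at 0)"
        by (rule has_derivative_compose[rotated]) (auto intro!: derivative_eq_intros)
      then show ?thesis by (simp add: has_field_derivative_def mult.commute[of _ "w \<bullet> n"])
    qed
    have zero: "\<phi> p = 0" "\<phi>' p = 0" using S pS by blast+
    have n0: "n \<bullet> n > 0" using S by (simp add: n_def)
    obtain d1 where d1: "d1 > 0" "\<And>\<tau>. 0 < \<tau> \<Longrightarrow> \<tau> < d1 \<Longrightarrow> \<phi> (p + \<tau> *\<^sub>R (v + e *\<^sub>R n)) > 0"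
      using DERIV_pos_inc_right[OF der[of "v + e *\<^sub>R n"]] v e n0 zero
      by (auto simp: inner_add_left n_def)
    obtain d2 where d2: "d2 > 0" "\<And>\<tau>. 0 < \<tau> \<Longrightarrow> \<tau> < d2 \<Longrightarrow> \<phi> (p + \<tau> *\<^sub>R (v + (- e) *\<^sub>R n)) < 0"
      using DERIV_neg_dec_right[OF der[of "v + (- e) *\<^sub>R n"]] v e n0 zero
      by (auto simp: inner_diff_left n_def)
    define \<delta> where "\<delta> = \<bar>m\<bar> / (4 * R)"
    have \<delta>: "\<delta> > 0" using m R by (simp add: \<delta>_def)
    have "(\<phi>' has_derivative (\<lambda>h. h \<bullet> n')) (at p)" using S by (simp add: gderiv_def)
    then obtain d3 where d3: "d3 > 0"
      "\<And>y. norm (y - p) < d3 \<Longrightarrow> norm (\<phi>' y - \<phi>' p - (y - p) \<bullet> n') \<le> \<delta> * norm (y - p)"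
      using \<delta> unfolding has_derivative_at_alt by blast
    obtain d4 where d4: "d4 > 0" "ball p d4 \<subseteq> N \<inter> N'"
      using S by (meson IntI open_Int openE)
    define \<tau> where "\<tau> = min (min d1 d2) (min d3 d4) / (2 * (R + 1))"
    have min_pos: "min (min d1 d2) (min d3 d4) > 0" using d1 d2 d3 d4 by simp
    have \<tau>: "\<tau> > 0" using min_pos R by (simp add: \<tau>_def)
    have "\<tau> * (2 * (R + 1)) = min (min d1 d2) (min d3 d4)" using R by (simp add: \<tau>_def)
    moreover have "\<tau> * (R + 1) < \<tau> * (2 * (R + 1))" using \<tau> R by simp
    ultimately have "\<tau> * R + \<tau> < min (min d1 d2) (min d3 d4)" by (simp add: algebra_simps)
    moreover have "\<tau> * R > 0" using \<tau> R by simp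
    ultimately have t1: "\<tau> < d1" and t2: "\<tau> < d2" and t3: "\<tau> * R < d3" and t4: "\<tau> * R < d4"
      using \<tau> by auto
    define y where "y r = p + \<tau> *\<^sub>R (v + r *\<^sub>R n)" for r
    have y_norm: "norm (y r - p) \<le> \<tau> * R" if "r \<in> {-e..e}" for r
    proof -
      have "\<bar>r\<bar> * norm n \<le> e * norm n" using that by (intro mult_right_mono) auto
      then have "norm (v + r *\<^sub>R n) \<le> R"
        using norm_triangle_ineq[of v "r *\<^sub>R n"] by (simp add: R_def)
      then show ?thesis using \<tau> by (simp add: y_def)
    qed
    have yN: "y r \<in> N" "y r \<in> N'" if "r \<in> {-e..e}" for r
    proof -
      have "y r \<in> ball p d4"
        using y_norm[OF that] t4 by (simp add: dist_norm norm_minus_commute)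
      then show "y r \<in> N" "y r \<in> N'" using d4 by auto
    qed
    have contN: "continuous_on N \<phi>"
      using S by (intro continuous_at_imp_continuous_on ballI)
        (auto simp: gderiv_def intro: has_derivative_continuous)
    have "continuous_on {-e..e} y" unfolding y_def by (intro continuous_intros)
    then have "continuous_on {-e..e} (\<lambda>r. \<phi> (y r))"
      by (rule continuous_on_compose2[OF contN]) (use yN in auto)
    moreover have "\<phi> (y (- e)) \<le> 0" "\<phi> (y e) \<ge> 0"
      using d1(2)[OF \<tau> t1] d2(2)[OF \<tau> t2] by (auto simp: y_def)
    ultimately obtain r where r: "-e \<le> r" "r \<le> e" "\<phi> (y r) = 0"
      using IVT'[of "\<lambda>r. \<phi> (y r)" "-e" 0 e] e by auto
    have rin: "r \<in> {-e..e}" using r by simp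
    have "y r \<in> S" using yN[OF rin] r S by blast
    then have "\<phi>' (y r) = 0" using yN[OF rin] S by blast
    moreover have "norm (y r - p) < d3" using y_norm[OF rin] t3 by simp
    ultimately have "\<bar>(y r - p) \<bullet> n'\<bar> \<le> \<delta> * norm (y r - p)"
      using d3(2)[of "y r"] zero by simp
    also have "\<dots> \<le> \<delta> * (\<tau> * R)" using y_norm[OF rin] \<delta> by (intro mult_left_mono) auto
    also have "\<dots> = \<tau> * (\<bar>m\<bar> / 4)" using R by (simp add: \<delta>_def)
    finally have "\<tau> * \<bar>m + r * (n \<bullet> n')\<bar> \<le> \<tau> * (\<bar>m\<bar> / 4)"
      using \<tau> by (simp add: y_def inner_add_left m_def abs_mult flip: distrib_left)
    then have up: "\<bar>m + r * (n \<bullet> n')\<bar> \<le> \<bar>m\<bar> / 4" using \<tau> by simp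
    have "\<bar>r * (n \<bullet> n')\<bar> \<le> e * \<bar>n \<bullet> n'\<bar>"
      using rin by (auto simp: abs_mult intro!: mult_right_mono)
    with up em m show False by linarith
  qed
  have le: "P \<subseteq> Q" if PQ: "has_tangent_plane S p P" "has_tangent_plane S p Q" for P Q
  proof -
    have "p \<in> S" using PQ by (simp add: has_tangent_plane_def)
    obtain N \<phi> g where 1: "open N \<and> p \<in> N \<and> (\<forall>x\<in>N. GDERIV \<phi> x :> g x) \<and>
        continuous_on N g \<and> (\<forall>x\<in>N. g x \<noteq> 0) \<and> S \<inter> N = {x \<in> N. \<phi> x = 0} \<and>
        P = {v. v \<bullet> g p = 0}"
      using PQ(1) unfolding has_tangent_plane_def by (elim conjE exE) blast
    obtain N' \<phi>' g' where 2: "open N' \<and> p \<in> N' \<and> (\<forall>x\<in>N'. GDERIV \<phi>' x :> g' x) \<and>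
        continuous_on N' g' \<and> (\<forall>x\<in>N'. g' x \<noteq> 0) \<and> S \<inter> N' = {x \<in> N'. \<phi>' x = 0} \<and>
        Q = {v. v \<bullet> g' p = 0}"
      using PQ(2) unfolding has_tangent_plane_def by (elim conjE exE) blast
    show ?thesis
      using 1 2 sub[of N \<phi> g N' \<phi>' "g' p"] \<open>p \<in> S\<close> by auto
  qed
  show ?thesis using le assms by blast
qed

end

theory Submission
  imports Defs
begin

text \<open>
  A state \<open>(u, v)\<close> is the left state of a fold point iff the quadratic form cutting out the
  directions over \<open>(u, v)\<close> has a double root, so \<open>Tf\<close> is the pullback of an ellipse under
  \<open>(t, z, Y) \<mapsto> (u, v)\<close>, whose derivative in \<open>(t, Y)\<close> is invertible.  A Hugoniot' curve is a graph
  over \<open>z\<close>; differentiating the speed along it gives the polynomial equation of \<open>Son'\<close>.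
  Restricted to the characteristic surface, and likewise to \<open>Son'\<close> away from \<open>z = 0\<close>, the
  equation of \<open>Tf\<close> is a perfect square up to a nonvanishing factor, so at every common point the
  gradients are parallel.  The points of \<open>Son'\<close> with \<open>z = 0\<close> are treated directly.
\<close>

lemma GDERIV_tripleI:
  fixes f :: "real \<times> real \<times> real \<Rightarrow> real"
  assumes "(f has_derivative (\<lambda>h. fst h * a + fst (snd h) * b + snd (snd h) * d)) (at x)"
  shows "GDERIV f x :> (a, b, d)"
  using assms by (simp add: gderiv_def inner_prod_def add.assoc)

lemma has_tangent_plane_level_set:
  assumes "\<And>x. GDERIV \<phi> x :> g x" "continuous_on UNIV g"
    and "\<And>x. \<phi> x = 0 \<Longrightarrow> g x \<noteq> 0" "\<phi> p = 0"
  shows "has_tangent_plane {x. \<phi> x = 0} p {v. v \<bullet> g p = 0}"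
proof -
  have "open {x. g x \<noteq> 0}"
    using assms(2) by (intro open_Collect_neq continuous_intros)
  moreover have "continuous_on {x. g x \<noteq> 0} g"
    using assms(2) by (rule continuous_on_subset) simp
  ultimately show ?thesis
    unfolding has_tangent_plane_def using assms
    by (intro conjI exI[of _ "{x. g x \<noteq> 0}"] exI[of _ \<phi>] exI[of _ g]) auto
qed

lemma tangent_level_sets:
  assumes \<phi>: "\<And>x. GDERIV \<phi> x :> g x" "continuous_on UNIV g" "\<And>x. \<phi> x = 0 \<Longrightarrow> g x \<noteq> 0"
    and \<psi>: "\<And>x. GDERIV \<psi> x :> h x" "continuous_on UNIV h" "\<And>x. \<psi> x = 0 \<Longrightarrow> h x \<noteq> 0"
    and meet: "\<phi> q = 0" "\<psi> q = 0"
    and parallel: "\<And>x. \<phi> x = 0 \<Longrightarrow> \<psi> x = 0 \<Longrightarrow> \<exists>k. g x = k *\<^sub>R h x"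
  shows "tangent_surfaces {x. \<phi> x = 0} {x. \<psi> x = 0}"
proof -
  have "\<exists>P. has_tangent_plane {x. \<phi> x = 0} p P \<and> has_tangent_plane {x. \<psi> x = 0} p P"
    if p: "\<phi> p = 0" "\<psi> p = 0" for p
  proof -
    obtain k where k: "g p = k *\<^sub>R h p" using parallel p by blast
    with \<phi>(3)[of p] p have "k \<noteq> 0" by auto
    with k have "{v. v \<bullet> g p = 0} = {v. v \<bullet> h p = 0}" by simp
    then show ?thesis
      using has_tangent_plane_level_set[of \<phi> g p] has_tangent_plane_level_set[of \<psi> h p]
        \<phi> \<psi> p by auto
  qed
  then show ?thesis
    unfolding tangent_surfaces_def regular_surface_def
    using has_tangent_plane_level_set[of \<phi> g] has_tangent_plane_level_set[of \<psi> h] \<phi> \<psi> meet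
    by fastforce
qed

text \<open>
  On \<open>\<psi> = 0\<close> the function \<open>\<phi>\<close> is a square up to the factor \<open>a\<close>, so it vanishes there to
  second order.
\<close>

lemma gradients_parallel_if_square:
  fixes \<phi> \<psi> a Q k :: "'a::real_inner \<Rightarrow> real"
  assumes "GDERIV \<phi> p :> g" "GDERIV \<psi> p :> h"
    and eq: "\<And>x. a x * \<phi> x = (Q x)\<^sup>2 + k x * \<psi> x"
    and diff: "a differentiable at p" "Q differentiable at p" "k differentiable at p"
    and zero: "\<phi> p = 0" "\<psi> p = 0" and "a p \<noteq> 0"
  shows "\<exists>l. g = l *\<^sub>R h"
proof -
  obtain a' Q' k' where d: "(a has_derivative a') (at p)" "(Q has_derivative Q') (at p)"
      "(k has_derivative k') (at p)"
    using diff unfolding differentiable_def by blast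
  have Q: "Q p = 0" using eq[of p] zero by simp
  have "((\<lambda>x. a x * \<phi> x) has_derivative (\<lambda>v. a p * (v \<bullet> g))) (at p)"
    using assms(1) d by (auto simp: gderiv_def zero intro!: derivative_eq_intros)
  moreover have "((\<lambda>x. (Q x)\<^sup>2 + k x * \<psi> x) has_derivative (\<lambda>v. k p * (v \<bullet> h))) (at p)"
    using assms(2) d by (auto simp: gderiv_def zero Q intro!: derivative_eq_intros)
  ultimately have "(\<lambda>v. a p * (v \<bullet> g)) = (\<lambda>v. k p * (v \<bullet> h))"
    unfolding eq by (rule has_derivative_unique)
  then have "v \<bullet> g = v \<bullet> ((k p / a p) *\<^sub>R h)" for v
    using \<open>a p \<noteq> 0\<close> by (simp add: fun_eq_iff field_simps)
  then have "g = (k p / a p) *\<^sub>R h" by (metis vector_eq_ldot)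
  then show ?thesis by blast
qed

lemma differentiable_coordinates:
  fixes p :: "real \<times> real \<times> real"
  shows "fst differentiable at p" "(\<lambda>x. fst (snd x)) differentiable at p"
    "(\<lambda>x. snd (snd x)) differentiable at p"
  by (auto intro!: bounded_linear_imp_differentiable bounded_linear_fst
      bounded_linear_compose[OF bounded_linear_fst bounded_linear_snd]
      bounded_linear_compose[OF bounded_linear_snd bounded_linear_snd])

lemma sq_plus_one_neq_0: "z\<^sup>2 + 1 \<noteq> (0::real)"
  by (metis add.commute power_one sum_power2_eq_zero_iff zero_neq_one)

definition ellipse_A :: "real \<Rightarrow> real \<Rightarrow> real \<times> real \<times> real \<Rightarrow> real" where
  "ellipse_A b c = (\<lambda>(t, z, Y). 2 * c * z / (z\<^sup>2 + 1) + c * t * (z\<^sup>2 - 1) + b * z * Y / 2)"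

definition ellipse_B :: "real \<Rightarrow> real \<times> real \<times> real \<Rightarrow> real" where
  "ellipse_B c = (\<lambda>(t, z, Y). c / (z\<^sup>2 + 1) + c * t * z - c + Y / 2)"

definition Tf_fun :: "real \<Rightarrow> real \<Rightarrow> real \<times> real \<times> real \<Rightarrow> real" where
  "Tf_fun b c x = (ellipse_A b c x)\<^sup>2 + 4 * ellipse_B c x * (ellipse_B c x + c)"

definition Tf_grad :: "real \<Rightarrow> real \<Rightarrow> real \<times> real \<times> real \<Rightarrow> real \<times> real \<times> real" where
  "Tf_grad b c x = (case x of (t, z, Y) \<Rightarrow>
     (2 * ellipse_A b c x) *\<^sub>R (c * (z\<^sup>2 - 1),
        2 * c * (1 - z\<^sup>2) / (z\<^sup>2 + 1)\<^sup>2 + 2 * c * t * z + b * Y / 2, b * z / 2) +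
     (8 * ellipse_B c x + 4 * c) *\<^sub>R (c * z, c * t - 2 * c * z / (z\<^sup>2 + 1)\<^sup>2, 1 / 2))"

definition Son'_fun :: "real \<Rightarrow> real \<Rightarrow> real \<times> real \<times> real \<Rightarrow> real" where
  "Son'_fun b c = (\<lambda>(t, z, Y).
     - 2 * c * ((b + 1) * z ^ 5 + (b + 4) * z ^ 3 + 3 * z) * t
     + ((b + 1) * z ^ 4 + b * z\<^sup>2 - 1) * Y - 2 * c * ((b - 1) * z\<^sup>2 + 1))"

definition Son'_grad :: "real \<Rightarrow> real \<Rightarrow> real \<times> real \<times> real \<Rightarrow> real \<times> real \<times> real" where
  "Son'_grad b c = (\<lambda>(t, z, Y).
     (- 2 * c * ((b + 1) * z ^ 5 + (b + 4) * z ^ 3 + 3 * z),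
      - 2 * c * (5 * (b + 1) * z ^ 4 + 3 * (b + 4) * z\<^sup>2 + 3) * t
        + (4 * (b + 1) * z ^ 3 + 2 * b * z) * Y - 4 * c * (b - 1) * z,
      (b + 1) * z ^ 4 + b * z\<^sup>2 - 1))"

lemma GDERIV_ellipse_A:
  "GDERIV (ellipse_A b c) (t, z, Y) :> (c * (z\<^sup>2 - 1),
     2 * c * (1 - z\<^sup>2) / (z\<^sup>2 + 1)\<^sup>2 + 2 * c * t * z + b * Y / 2, b * z / 2)"
  unfolding ellipse_A_def case_prod_unfold
  apply (rule GDERIV_tripleI)
  apply (auto intro!: derivative_eq_intros simp: sq_plus_one_neq_0 fun_eq_iff)
  apply (simp add: divide_simps sq_plus_one_neq_0)
  apply (simp add: power2_eq_square algebra_simps)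
  done

lemma GDERIV_ellipse_B:
  "GDERIV (ellipse_B c) (t, z, Y) :> (c * z, c * t - 2 * c * z / (z\<^sup>2 + 1)\<^sup>2, 1 / 2)"
  unfolding ellipse_B_def case_prod_unfold
  apply (rule GDERIV_tripleI)
  apply (auto intro!: derivative_eq_intros simp: sq_plus_one_neq_0 fun_eq_iff)
  apply (simp add: divide_simps sq_plus_one_neq_0)
  apply (simp add: power2_eq_square algebra_simps)
  done

lemma GDERIV_Tf_fun: "GDERIV (Tf_fun b c) x :> Tf_grad b c x"
proof -
  obtain t z Y where x: "x = (t, z, Y)" by (cases x) auto
  obtain u where A: "(ellipse_A b c has_derivative (\<lambda>h. h \<bullet> u)) (at x)"
    and u: "u = (c * (z\<^sup>2 - 1),
      2 * c * (1 - z\<^sup>2) / (z\<^sup>2 + 1)\<^sup>2 + 2 * c * t * z + b * Y / 2, b * z / 2)"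
    using GDERIV_ellipse_A unfolding x gderiv_def by blast
  obtain v where B: "(ellipse_B c has_derivative (\<lambda>h. h \<bullet> v)) (at x)"
    and v: "v = (c * z, c * t - 2 * c * z / (z\<^sup>2 + 1)\<^sup>2, 1 / 2)"
    using GDERIV_ellipse_B unfolding x gderiv_def by blast
  have g: "Tf_grad b c x = (2 * ellipse_A b c x) *\<^sub>R u + (8 * ellipse_B c x + 4 * c) *\<^sub>R v"
    by (simp add: Tf_grad_def x u v)
  show ?thesis
    unfolding gderiv_def Tf_fun_def[abs_def] g
    by (rule derivative_eq_intros A B refl)+
      (simp add: fun_eq_iff inner_add_right algebra_simps)
qed

lemma continuous_Tf_grad: "continuous_on UNIV (Tf_grad b c)"
  unfolding Tf_grad_def ellipse_A_def ellipse_B_def case_prod_unfold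
  by (intro continuous_intros) (auto simp: sq_plus_one_neq_0)

lemma Tf_grad_neq_0:
  assumes "b > 1" "c > 0" "Tf_fun b c x = 0"
  shows "Tf_grad b c x \<noteq> 0"
proof
  obtain t z Y where x: "x = (t, z, Y)" by (cases x) auto
  define A B where "A = ellipse_A b c x" and "B = 8 * ellipse_B c x + 4 * c"
  assume "Tf_grad b c x = 0"
  then have g: "2 * A * (c * (z\<^sup>2 - 1)) + B * (c * z) = 0" "2 * A * (b * z / 2) + B / 2 = 0"
    by (simp_all add: Tf_grad_def x A_def B_def zero_prod_def)
  then have B: "B = - (2 * b * z * A)" by (simp add: algebra_simps)
  have "2 * c * A * ((b - 1) * z\<^sup>2 + 1) = 0"
    using g(1) unfolding B by (simp add: power2_eq_square algebra_simps)
  moreover have "(b - 1) * z\<^sup>2 + 1 > 0" using assms by (simp add: add_nonneg_pos)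
  ultimately have "A = 0" using assms by auto
  then have "ellipse_A b c x = 0" "ellipse_B c x = - c / 2" using B by (auto simp: A_def B_def)
  then have "Tf_fun b c x = - c\<^sup>2" by (simp add: Tf_fun_def power2_eq_square)
  then show False using assms by simp
qed

lemma GDERIV_Son'_fun: "GDERIV (Son'_fun b c) x :> Son'_grad b c x"
  unfolding Son'_fun_def Son'_grad_def case_prod_unfold
  apply (rule GDERIV_tripleI)
  apply (rule derivative_eq_intros refl)+
  apply (simp add: fun_eq_iff)
  apply (simp add: power2_eq_square power3_eq_cube power4_eq_xxxx algebra_simps)
  done

lemma continuous_Son'_grad: "continuous_on UNIV (Son'_grad b c)"
  unfolding Son'_grad_def case_prod_unfold by (intro continuous_intros)

lemma Son'_grad_neq_0:
  assumes "b > 1" "c > 0"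
  shows "Son'_grad b c x \<noteq> 0"
proof
  obtain t z Y where x: "x = (t, z, Y)" by (cases x) auto
  assume "Son'_grad b c x = 0"
  then have "c * ((b + 1) * z ^ 5 + (b + 4) * z ^ 3 + 3 * z) = 0"
    and q: "(b + 1) * z ^ 4 + b * z\<^sup>2 - 1 = 0"
    by (simp_all add: x Son'_grad_def zero_prod_def)
  then have "(b + 1) * z ^ 5 + (b + 4) * z ^ 3 + 3 * z = 0"
    using assms by (simp only: mult_eq_0_iff) simp
  then have "z * ((b + 1) * z ^ 4 + (b + 4) * z\<^sup>2 + 3) = 0"
    by (simp add: eval_nat_numeral algebra_simps)
  moreover have "(b + 1) * z ^ 4 + (b + 4) * z\<^sup>2 + 3 > 0"
    using assms by (simp add: add_nonneg_pos)
  ultimately have "z = 0" by auto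
  with q show False by simp
qed

definition Tf_quot :: "real \<Rightarrow> real \<Rightarrow> real \<times> real \<times> real \<Rightarrow> real" where
  "Tf_quot b c = (\<lambda>(t, z, Y). 2 * c * ((b - 1) * z\<^sup>2 + 1) / (z\<^sup>2 + 1)
     + c * t * z * (b * z\<^sup>2 + 4 - b) + Y * (b\<^sup>2 * z\<^sup>2 / 4 + 1))"

lemma Tf_fun_eq:
  "Tf_fun b c (t, z, Y) = (c * t * (z\<^sup>2 + 1))\<^sup>2 + Tf_quot b c (t, z, Y) * Y"
proof -
  define m where "m = inverse (z\<^sup>2 + 1)"
  have m: "m * (z\<^sup>2 + 1) - 1 = 0" using sq_plus_one_neq_0[of z] by (simp add: m_def)
  have "Tf_fun b c (t, z, Y) - ((c * t * (z\<^sup>2 + 1))\<^sup>2 + Tf_quot b c (t, z, Y) * Y)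
    = (4 * c\<^sup>2 * (m + t * z) + 2 * c * Y) * (m * (z\<^sup>2 + 1) - 1)"
    unfolding Tf_fun_def ellipse_A_def ellipse_B_def Tf_quot_def case_prod_conv
      divide_inverse m_def[symmetric]
    by (simp add: power2_eq_square algebra_simps)
  then show ?thesis unfolding m by simp
qed

text \<open>
  The sonic' equation is linear in \<open>t\<close>, and up to the factor \<open>- 2 c (z\<^sup>2 + 1)\<close> the coefficient
  of \<open>t\<close> is \<open>elim_coeff\<close>; eliminating \<open>t\<close> from the equation of \<open>Tf\<close> leaves the square of
  \<open>elim_root\<close>, which is affine in \<open>Y\<close>.
\<close>

definition elim_coeff :: "real \<Rightarrow> real \<times> real \<times> real \<Rightarrow> real" where
  "elim_coeff b = (\<lambda>(t, z, Y). z * ((b + 1) * z\<^sup>2 + 3))"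

definition elim_root :: "real \<Rightarrow> real \<Rightarrow> real \<times> real \<times> real \<Rightarrow> real" where
  "elim_root b c = (\<lambda>(t, z, Y). c * ((b - 1) * z\<^sup>2 + 1)
     + ((b + 1)\<^sup>2 * z ^ 4 + (2 * b + 6) * z\<^sup>2 + 1) * Y / 2)"

definition elim_quot :: "real \<Rightarrow> real \<Rightarrow> real \<times> real \<times> real \<Rightarrow> real" where
  "elim_quot b c = (\<lambda>(t, z, Y).
     ((z\<^sup>2 + 1) * c * ((b - 1) * z\<^sup>2 + 1)
       - (z\<^sup>2 + 1)\<^sup>2 * (z * ((b + 1) * z\<^sup>2 + 3) * c * t + ((b + 1) * z\<^sup>2 - 1) * Y / 2)
       - z\<^sup>2 * ((b + 1) * z\<^sup>2 + 3) * Y * (b * z\<^sup>2 + 4 - b)) / (2 * (z\<^sup>2 + 1)))"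

lemma Tf_fun_Son'_fun:
  "(elim_coeff b x)\<^sup>2 * Tf_fun b c x = (elim_root b c x)\<^sup>2 + elim_quot b c x * Son'_fun b c x"
proof -
  obtain t z Y where x: "x = (t, z, Y)" by (cases x) auto
  define n d q r s M \<kappa> G where
    "n = z\<^sup>2 + 1" and "d = c * ((b - 1) * z\<^sup>2 + 1)" and "q = (b + 1) * z\<^sup>2 - 1"
    and "r = z * ((b + 1) * z\<^sup>2 + 3)"
    and "s = (b + 1)\<^sup>2 * z ^ 4 + (2 * b + 6) * z\<^sup>2 + 1" and "M = z * (b * z\<^sup>2 + 4 - b)"
    and "\<kappa> = b\<^sup>2 * z\<^sup>2 / 4 + 1"
    and "G = n * d - n\<^sup>2 * (r * (c * t) + q * Y / 2) - r * Y * M"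
  have n: "n \<noteq> 0" using sq_plus_one_neq_0 by (simp add: n_def)
  have 1: "n * (s + n * q) + r * M - 2 * r\<^sup>2 = 0"
    unfolding n_def s_def q_def r_def M_def
    by (simp add: eval_nat_numeral algebra_simps)
  have 2: "s\<^sup>2 - n\<^sup>2 * q\<^sup>2 - 2 * r * M * q - 4 * \<kappa> * r\<^sup>2 = 0"
    unfolding n_def s_def q_def r_def M_def \<kappa>_def
    by (simp add: eval_nat_numeral field_simps)
  have S: "Son'_fun b c x = 2 * (n * q * Y / 2 - d - n * r * (c * t))"
    unfolding x Son'_fun_def n_def q_def d_def r_def
    by (simp add: eval_nat_numeral field_simps)
  have R: "elim_coeff b x = r" by (simp add: x elim_coeff_def r_def)
  have Q: "elim_root b c x = d + s * Y / 2" by (simp add: x elim_root_def d_def s_def)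
  have G: "elim_quot b c x = G / (2 * n)"
    unfolding x elim_quot_def case_prod_conv n_def[symmetric] G_def
    by (simp add: q_def d_def M_def r_def power2_eq_square[of z] mult_ac)
  have T: "n * Tf_fun b c x
      = n * (c * t * n)\<^sup>2 + (2 * d + n * (c * t) * M + n * Y * \<kappa>) * Y"
    using n unfolding x Tf_fun_eq Tf_quot_def
    by (simp add: n_def[symmetric] \<kappa>_def[symmetric]) (simp add: M_def d_def field_simps)
  have "r\<^sup>2 * (n * Tf_fun b c x) - (n * (d + s * Y / 2)\<^sup>2 + G * (Son'_fun b c x / 2))
    = - Y * d * (n * (s + n * q) + r * M - 2 * r\<^sup>2)
      - n * Y\<^sup>2 / 4 * (s\<^sup>2 - n\<^sup>2 * q\<^sup>2 - 2 * r * M * q - 4 * \<kappa> * r\<^sup>2)"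
    unfolding T S G_def by (simp add: power2_eq_square field_simps)
  then have "r\<^sup>2 * (n * Tf_fun b c x) = n * (d + s * Y / 2)\<^sup>2 + G * (Son'_fun b c x / 2)"
    unfolding 1 2 by simp
  then show ?thesis unfolding R Q G using n by (simp add: field_simps)
qed

lemma tangent_Tf_char:
  assumes "b > 1" "c > 0"
  shows "tangent_surfaces {x. Tf_fun b c x = 0} {x. snd (snd x) = (0::real)}"
proof (rule tangent_level_sets[OF GDERIV_Tf_fun continuous_Tf_grad Tf_grad_neq_0])
  show Y: "GDERIV (\<lambda>x. snd (snd x)) x :> (0, 0, 1)" for x :: "real \<times> real \<times> real"
    by (rule GDERIV_tripleI) (auto intro!: derivative_eq_intros)
  show "Tf_fun b c (0, 0, 0) = 0" "snd (snd (0, 0, 0)) = (0::real)"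
    by (simp_all add: Tf_fun_eq)
  show "(0::real, 0::real, 1::real) \<noteq> 0" by (simp add: zero_prod_def)
  fix x :: "real \<times> real \<times> real"
  assume x0: "Tf_fun b c x = 0" "snd (snd x) = 0"
  have eq: "1 * Tf_fun b c x
      = (c * fst x * ((fst (snd x))\<^sup>2 + 1))\<^sup>2 + Tf_quot b c x * snd (snd x)" for x
    by (cases x) (simp add: Tf_fun_eq)
  show "\<exists>l. Tf_grad b c x = l *\<^sub>R (0, 0, 1)"
    by (rule gradients_parallel_if_square[OF GDERIV_Tf_fun Y eq _ _ _ x0])
      (auto simp: Tf_quot_def case_prod_unfold sq_plus_one_neq_0
        intro!: derivative_intros differentiable_coordinates)
qed (use assms in auto)

lemma tangent_Tf_Son':
  assumes "b > 1" "c > 0"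
  shows "tangent_surfaces {x. Tf_fun b c x = 0} {x. Son'_fun b c x = 0}"
proof (rule tangent_level_sets[OF GDERIV_Tf_fun continuous_Tf_grad Tf_grad_neq_0
      GDERIV_Son'_fun continuous_Son'_grad Son'_grad_neq_0])
  show "Tf_fun b c (0, 0, - 2 * c) = 0" "Son'_fun b c (0, 0, - 2 * c) = 0"
    by (simp_all add: Tf_fun_def ellipse_A_def ellipse_B_def Son'_fun_def)
  fix x assume x0: "Tf_fun b c x = 0" "Son'_fun b c x = 0"
  obtain t z Y where x: "x = (t, z, Y)" by (cases x) auto
  show "\<exists>l. Tf_grad b c x = l *\<^sub>R Son'_grad b c x"
  proof (cases "z = 0")
    case True
    then have Y: "Y = - 2 * c" using x0(2) by (simp add: x Son'_fun_def)
    then have "t = 0"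
      using x0(1) assms True by (simp add: x Tf_fun_def ellipse_A_def ellipse_B_def)
    then show ?thesis
      using True Y by (intro exI[of _ "2 * c"])
        (simp add: x Tf_grad_def Son'_grad_def ellipse_A_def ellipse_B_def)
  next
    case False
    moreover have "(b + 1) * z\<^sup>2 + 3 > 0" using assms by (simp add: add_nonneg_pos)
    ultimately have "elim_coeff b x \<noteq> 0" by (auto simp: x elim_coeff_def)
    moreover have "2 * w\<^sup>2 + 2 \<noteq> 0" for w :: real by (smt (verit) zero_le_power2)
    ultimately show ?thesis
      by (intro gradients_parallel_if_square[OF GDERIV_Tf_fun GDERIV_Son'_fun Tf_fun_Son'_fun _ _ _ x0])
        (auto simp: elim_coeff_def elim_root_def elim_quot_def case_prod_unfold sq_plus_one_neq_0
          intro!: derivative_intros differentiable_coordinates)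
  qed
qed (use assms in auto)

lemma unique_root_line_iff:
  fixes P S R :: real
  assumes "P \<noteq> R"
  shows "(\<exists>!L. \<exists>p q. (p, q) \<noteq> (0, 0) \<and> L = span {(p, q)} \<and> P * p\<^sup>2 - S * p * q - R * q\<^sup>2 = 0)
    \<longleftrightarrow> S\<^sup>2 + 4 * P * R = 0" (is "(\<exists>!L. ?root L) \<longleftrightarrow> _")
proof
  assume ex: "\<exists>!L. ?root L"
  then obtain p q where pq: "(p, q) \<noteq> (0, 0)" "P * p\<^sup>2 - S * p * q - R * q\<^sup>2 = 0" by blast
  have same: "\<exists>k. p' = k * p \<and> q' = k * q"
    if "(p', q') \<noteq> (0, 0)" "P * p'\<^sup>2 - S * p' * q' - R * q'\<^sup>2 = 0" for p' q'
  proof -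
    have "?root (span {(p', q')})" "?root (span {(p, q)})" using pq that by blast+
    with ex have "span {(p', q')} = span {(p, q)}" by (elim ex1E) metis
    then show ?thesis by (metis insertI1 span_base span_pair_iff)
  qed
  show "S\<^sup>2 + 4 * P * R = 0"
  proof (rule ccontr)
    assume disc: "S\<^sup>2 + 4 * P * R \<noteq> 0"
    show False
    proof (cases "q = 0")
      case True
      with pq have P: "P = 0" by simp
      with disc have "S \<noteq> 0" by simp
      then show False using same[of R "- S"] True P by (auto simp: power2_eq_square)
    next
      case False
      have "P * (P * p - S * q)\<^sup>2 - S * (P * p - S * q) * (- P * q) - R * (- P * q)\<^sup>2
          = P\<^sup>2 * (P * p\<^sup>2 - S * p * q - R * q\<^sup>2)"
        by (simp add: power2_eq_square algebra_simps)
      moreover have "(P * p - S * q, - P * q) \<noteq> (0, 0)" using False disc by auto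
      ultimately obtain k where k: "P * p - S * q = k * p" "- P * q = k * q"
        using same[of "P * p - S * q" "- P * q"] pq by auto
      have "(k + P) * q = 0" using k(2) by (simp add: algebra_simps)
      then have "k = - P" using False by simp
      then have Sq: "S * q = 2 * P * p" using k(1) by simp
      have "q\<^sup>2 * (S\<^sup>2 + 4 * P * R) = (S * q)\<^sup>2 + 4 * P * (P * p\<^sup>2 - S * q * p)
          - 4 * P * (P * p\<^sup>2 - S * p * q - R * q\<^sup>2)"
        by (simp add: power2_eq_square algebra_simps)
      also have "\<dots> = 0" unfolding pq Sq by (simp add: power2_eq_square algebra_simps)
      finally show False using False disc by simp
    qed
  qed
next
  assume disc: "S\<^sup>2 + 4 * P * R = 0"
  define p0 q0 where "p0 = (if P = 0 then 1 else S)" and "q0 = 2 * P"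
  have ne: "(p0, q0) \<noteq> (0, 0)" by (auto simp: p0_def q0_def)
  have S0: "S = 0" if "P = 0" using disc that by simp
  have "P * S\<^sup>2 - S * S * (2 * P) - R * (2 * P)\<^sup>2 = - P * (S\<^sup>2 + 4 * P * R)"
    by (simp add: power2_eq_square algebra_simps)
  then have root0: "P * p0\<^sup>2 - S * p0 * q0 - R * q0\<^sup>2 = 0"
    unfolding disc by (auto simp: p0_def q0_def)
  have "span {(p, q)} = span {(p0, q0)}"
    if pq: "(p, q) \<noteq> (0, 0)" "P * p\<^sup>2 - S * p * q - R * q\<^sup>2 = 0" for p q
  proof -
    obtain k where k: "p = k * p0" "q = k * q0"
    proof (cases "P = 0")
      case True
      then have "q = 0" using pq S0 assms by simp
      with True show ?thesis by (intro that[of p]) (auto simp: p0_def q0_def)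
    next
      case False
      have "(2 * P * p - S * q)\<^sup>2
          = 4 * P * (P * p\<^sup>2 - S * p * q - R * q\<^sup>2) + q\<^sup>2 * (S\<^sup>2 + 4 * P * R)"
        by (simp add: power2_eq_square algebra_simps)
      then have "2 * P * p = S * q" unfolding pq disc by simp
      with False show ?thesis
        by (intro that[of "q / (2 * P)"]) (auto simp: p0_def q0_def field_simps)
    qed
    then have "k \<noteq> 0" using pq by auto
    have "span {k *\<^sub>R (p0, q0)} = span {(p0, q0)}"
      using span_image_scale[of "{(p0, q0)}" "\<lambda>_. k"] \<open>k \<noteq> 0\<close> by simp
    with k show ?thesis by simp
  qed
  then have "L = span {(p0, q0)}" if "?root L" for L using that by metis
  moreover have "?root (span {(p0, q0)})" using ne root0 by blast
  ultimately show "\<exists>!L. ?root L" by (rule ex1I[rotated])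
qed

lemma fold_curve_left_state_iff:
  assumes "a3 \<noteq> a2"
  shows "(\<exists>m \<in> fold_curve a1 a2 a3 a4 b1. left_state m = (u, v)) \<longleftrightarrow>
    (b1 * u + a1 - a4)\<^sup>2 + 4 * (v + a2) * (v + a3) = 0"
proof -
  define root where "root L \<longleftrightarrow> (\<exists>p q. (p, q) \<noteq> (0, 0) \<and> L = span {(p, q)} \<and>
    (v + a3) * p\<^sup>2 - (b1 * u + a1 - a4) * p * q - (v + a2) * q\<^sup>2 = 0)" for L
  have zero: "(0, 0) \<in> span {(p, q)}" for p q :: real by (simp flip: zero_prod_def add: span_zero)
  define line :: "(real \<times> real) set \<Rightarrow> wave_point" where "line L = (u, v, 0, 0, L)" for L
  have inj: "inj line" by (auto simp: line_def inj_on_def)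
  have manifold: "(u, v, 0, 0, L) \<in> wave_manifold a1 a2 a3 a4 b1 \<longleftrightarrow> root L" for L
  proof -
    have eq: "(p\<^sup>2 - q\<^sup>2) * (v + a2) - p * q * (b1 * u + a1 - a4) + (a3 - a2) * p\<^sup>2
        = (v + a3) * p\<^sup>2 - (b1 * u + a1 - a4) * p * q - (v + a2) * q\<^sup>2" for p q
      by (simp add: algebra_simps)
    show ?thesis
      unfolding wave_manifold_def mem_Collect_eq case_prod_conv root_def eq using zero by blast
  qed
  have char: "m \<in> characteristic a1 a2 a3 a4 b1 \<and> left_state m = (u, v) \<longleftrightarrow>
      m \<in> line ` {L. root L}" for m
    by (cases m) (auto simp: characteristic_def left_state_def line_def manifold)
  have hug: "hugoniot a1 a2 a3 a4 b1 m \<inter> characteristic a1 a2 a3 a4 b1 = line ` {L. root L}"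
    if "left_state m = (u, v)" for m
  proof -
    have "hugoniot a1 a2 a3 a4 b1 m \<inter> characteristic a1 a2 a3 a4 b1
        = {m' \<in> characteristic a1 a2 a3 a4 b1. left_state m' = (u, v)}"
      using that by (auto simp: hugoniot_def characteristic_def)
    with char show ?thesis by blast
  qed
  have "m \<in> fold_curve a1 a2 a3 a4 b1 \<and> left_state m = (u, v) \<longleftrightarrow>
      m \<in> line ` {L. root L} \<and> line ` {L. root L} = {m}" for m
    unfolding char[symmetric] fold_curve_def using hug[of m] by blast
  then have "(\<exists>m \<in> fold_curve a1 a2 a3 a4 b1. left_state m = (u, v)) \<longleftrightarrow>
      (\<exists>L. line ` {L. root L} = line ` {L})"
    by (metis (no_types, lifting) image_insert image_empty insertI1 imageE)
  also have "\<dots> \<longleftrightarrow> (\<exists>L. {L. root L} = {L})"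
    unfolding inj_image_eq_iff[OF inj] ..
  also have "\<dots> \<longleftrightarrow> (\<exists>!L. root L)" by blast
  also have "\<dots> \<longleftrightarrow> (b1 * u + a1 - a4)\<^sup>2 + 4 * (v + a3) * (v + a2) = 0"
    unfolding root_def using assms by (intro unique_root_line_iff) simp
  also have "\<dots> \<longleftrightarrow> (b1 * u + a1 - a4)\<^sup>2 + 4 * (v + a2) * (v + a3) = 0"
    by (simp only: mult.assoc mult.commute[of "v + a3"])
  finally show ?thesis .
qed

lemma chart_in_wave_manifold:
  assumes "b1 \<noteq> 0" "a3 - a2 \<noteq> 0"
  shows "chart a1 a2 a3 a4 b1 x \<in> wave_manifold a1 a2 a3 a4 b1"
  using bij_betwE[OF chart_bij_betw[OF assms]] by blast

lemma b1_coord_U: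
  assumes "b1 \<noteq> 0"
  shows "b1 * coord_U a1 a2 a3 a4 b1 t z + a1 - a4
    = 2 * (a3 - a2) * z / (z\<^sup>2 + 1) + (a3 - a2) * t * (z\<^sup>2 - 1)"
  using assms by (simp add: coord_U_def)

lemma Tf_eq:
  assumes "b1 \<noteq> 0" "a3 - a2 \<noteq> 0"
  shows "Tf a1 a2 a3 a4 b1 = {x. Tf_fun b1 (a3 - a2) x = 0}"
proof (intro set_eqI)
  fix x :: "real \<times> real \<times> real"
  obtain t z Y where x: "x = (t, z, Y)" by (cases x) auto
  obtain u v where uv: "left_state (chart a1 a2 a3 a4 b1 x) = (u, v)" by fastforce
  have u: "u = coord_U a1 a2 a3 a4 b1 t z + z * Y / 2" and v: "v = coord_V a2 a3 t z + Y / 2"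
    using uv by (simp_all add: x chart_def left_state_def)
  have "b1 * u + a1 - a4 = (b1 * coord_U a1 a2 a3 a4 b1 t z + a1 - a4) + b1 * z * Y / 2"
    by (simp add: u algebra_simps)
  then have "b1 * u + a1 - a4 = ellipse_A b1 (a3 - a2) x"
    unfolding b1_coord_U[OF assms(1)] by (simp add: x ellipse_A_def)
  moreover have "v + a2 = ellipse_B (a3 - a2) x"
    by (simp add: x v coord_V_def ellipse_B_def)
  moreover have "v + a3 = ellipse_B (a3 - a2) x + (a3 - a2)"
    using calculation(2) by simp
  moreover have "x \<in> Tf a1 a2 a3 a4 b1 \<longleftrightarrow>
      (\<exists>m \<in> fold_curve a1 a2 a3 a4 b1. left_state m = (u, v))"
    using chart_in_wave_manifold[OF assms] uv by (auto simp: Tf_def hugoniot_def eq_commute[of "(u, v)"])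
  moreover have "a3 \<noteq> a2" using assms by simp
  ultimately show "x \<in> Tf a1 a2 a3 a4 b1 \<longleftrightarrow> x \<in> {x. Tf_fun b1 (a3 - a2) x = 0}"
    by (simp only: fold_curve_left_state_iff[OF \<open>a3 \<noteq> a2\<close>] Tf_fun_def mem_Collect_eq)
qed

lemma char_surface_eq:
  assumes "b1 \<noteq> 0" "a3 - a2 \<noteq> 0"
  shows "char_surface a1 a2 a3 a4 b1 = {x. snd (snd x) = 0}"
proof (intro set_eqI)
  fix x :: "real \<times> real \<times> real"
  obtain t z Y where x: "x = (t, z, Y)" by (cases x) auto
  show "x \<in> char_surface a1 a2 a3 a4 b1 \<longleftrightarrow> x \<in> {x. snd (snd x) = 0}"
    using chart_in_wave_manifold[OF assms, of a1 a4 x]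
    by (auto simp: x char_surface_def characteristic_def chart_def)
qed

lemma right_state_coords_iff:
  fixes b c t z Y \<alpha> \<beta> :: real
  assumes "b > 1" "c > 0"
  defines "D \<equiv> (b - 1) * z\<^sup>2 + 1"
  shows "2 * c * z / (z\<^sup>2 + 1) + c * t * (z\<^sup>2 - 1) - b * z * Y / 2 = \<alpha> \<and>
      c / (z\<^sup>2 + 1) + c * t * z - Y / 2 = \<beta> \<longleftrightarrow>
    t = (b * z * \<beta> - \<alpha> + (2 - b) * c * z / (z\<^sup>2 + 1)) / (c * D) \<and>
    Y = 2 * ((z\<^sup>2 - 1) * \<beta> - z * \<alpha> + c) / D" (is "?A = \<alpha> \<and> ?B = \<beta> \<longleftrightarrow> t = ?t / _ \<and> Y = ?Y / _")
proof -
  define m where "m = inverse (z\<^sup>2 + 1)"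
  have m: "m * (z\<^sup>2 + 1) - 1 = 0" using sq_plus_one_neq_0[of z] by (simp add: m_def)
  have D: "D > 0" using assms by (simp add: D_def add_nonneg_pos)
  have "t = ?t / (c * D) \<and> Y = ?Y / D \<longleftrightarrow> c * D * t = ?t \<and> D * Y = ?Y"
    using D \<open>c > 0\<close> by (simp add: nonzero_eq_divide_eq mult_ac)
  also have "\<dots> \<longleftrightarrow> ?A = \<alpha> \<and> ?B = \<beta>"
  proof (intro iffI conjI; elim conjE)
    assume eq: "c * D * t = ?t" "D * Y = ?Y"
    have "D * (?A - \<alpha>) = (z\<^sup>2 - 1) * (c * D * t - ?t) - b * z / 2 * (D * Y - ?Y)
        + b * c * z * (m * (z\<^sup>2 + 1) - 1)"
      unfolding divide_inverse m_def[symmetric] D_def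
      by (simp add: power2_eq_square algebra_simps)
    then show "?A = \<alpha>" unfolding m eq using D by simp
    have "D * (?B - \<beta>) = z * (c * D * t - ?t) - (D * Y - ?Y) / 2
        + c * (m * (z\<^sup>2 + 1) - 1)"
      unfolding divide_inverse m_def[symmetric] D_def
      by (simp add: power2_eq_square algebra_simps)
    then show "?B = \<beta>" unfolding m eq using D by simp
  next
    assume eq: "?A = \<alpha>" "?B = \<beta>"
    show "c * D * t = ?t"
      unfolding eq[symmetric] divide_inverse m_def[symmetric] D_def
      by (simp add: power2_eq_square algebra_simps)
    have "D * Y - ?Y = 2 * c * (m * (z\<^sup>2 + 1) - 1)"
      unfolding eq[symmetric] divide_inverse m_def[symmetric] D_def
      by (simp add: power2_eq_square field_simps)
    then show "D * Y = ?Y" unfolding m by simp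
  qed
  finally show ?thesis by simp
qed

lemma Son'_eq:
  assumes "b1 > 1" "a3 - a2 > 0"
  shows "Son' a1 a2 a3 a4 b1 = {x. Son'_fun b1 (a3 - a2) x = 0}"
proof (intro set_eqI)
  fix x :: "real \<times> real \<times> real"
  obtain t0 z0 Y0 where x: "x = (t0, z0, Y0)" by (cases x) auto
  define c where "c = a3 - a2"
  have c: "c > 0" using assms by (simp add: c_def)
  obtain u v where uv: "right_state (chart a1 a2 a3 a4 b1 x) = (u, v)" by fastforce
  define \<alpha> \<beta> where "\<alpha> = b1 * u + a1 - a4" and "\<beta> = v + a3"
  define D where "D z = (b1 - 1) * z\<^sup>2 + 1" for z
  have D: "D z > 0" for z using assms by (simp add: D_def add_nonneg_pos)
  define T where "T z = (b1 * z * \<beta> - \<alpha> + (2 - b1) * c * z / (z\<^sup>2 + 1)) / (c * D z)" for z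
  define H where "H z = 2 * ((z\<^sup>2 - 1) * \<beta> - z * \<alpha> + c) / D z" for z
  define \<sigma> where "\<sigma> z = u + a4 + z * (H z + \<beta>)" for z
  define K where "K = chart a1 a2 a3 a4 b1 -`
    hugoniot' a1 a2 a3 a4 b1 (chart a1 a2 a3 a4 b1 x)"
  have K_iff: "(t, z, Y) \<in> K \<longleftrightarrow> t = T z \<and> Y = H z" for t z Y
  proof -
    have "(t, z, Y) \<in> K \<longleftrightarrow> coord_U a1 a2 a3 a4 b1 t z - z * Y / 2 = u \<and>
        coord_V a2 a3 t z - Y / 2 = v"
      using chart_in_wave_manifold[of b1 a3 a2] assms uv
      by (auto simp: K_def hugoniot'_def chart_def right_state_def)
    also have "\<dots> \<longleftrightarrow> 2 * c * z / (z\<^sup>2 + 1) + c * t * (z\<^sup>2 - 1) - b1 * z * Y / 2 = \<alpha> \<and>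
        c / (z\<^sup>2 + 1) + c * t * z - Y / 2 = \<beta>"
      using assms(1) by (auto simp: coord_U_def coord_V_def \<alpha>_def \<beta>_def c_def field_simps)
    also have "\<dots> \<longleftrightarrow> t = T z \<and> Y = H z"
      unfolding T_def H_def D_def using assms(1) c by (rule right_state_coords_iff)
    finally show ?thesis .
  qed
  have speed: "speed a1 a2 a3 a4 b1 y = \<sigma> (fst (snd y))" if "y \<in> K" for y
  proof -
    obtain t z Y where y: "y = (t, z, Y)" by (cases y) auto
    have "coord_U a1 a2 a3 a4 b1 t z - z * Y / 2 = u" "coord_V a2 a3 t z - Y / 2 = v"
      using that uv by (auto simp: y K_def hugoniot'_def chart_def right_state_def)
    moreover have "Y = H z" using that K_iff y by simp
    ultimately show ?thesis by (auto simp: y speed_def \<sigma>_def \<beta>_def algebra_simps)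
  qed
  have xK: "x \<in> K"
    using chart_in_wave_manifold[of b1 a3 a2] assms by (auto simp: K_def hugoniot'_def)
  then have tY: "t0 = T z0" "Y0 = H z0" using K_iff x by auto
  define s' where "s' = - Son'_fun b1 c x / (2 * (z0\<^sup>2 + 1) * D z0)"
  have \<sigma>': "(\<sigma> has_real_derivative s') (at z0)"
  proof -
    have \<alpha>\<beta>: "\<alpha> = 2 * c * z0 / (z0\<^sup>2 + 1) + c * t0 * (z0\<^sup>2 - 1) - b1 * z0 * Y0 / 2"
        "\<beta> = c / (z0\<^sup>2 + 1) + c * t0 * z0 - Y0 / 2"
      using right_state_coords_iff[OF assms(1) c, of z0 t0 Y0 \<alpha> \<beta>] tY
      by (auto simp: T_def H_def D_def)
    define h where "h = (2 * (2 * z0 * \<beta> - \<alpha>) - 2 * (b1 - 1) * z0 * H z0) / D z0"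
    have "((\<lambda>z. 2 * ((z\<^sup>2 - 1) * \<beta> - z * \<alpha> + c)) has_real_derivative 2 * (2 * z0 * \<beta> - \<alpha>))
        (at z0)"
      by (auto intro!: derivative_eq_intros)
    moreover have "(D has_real_derivative 2 * (b1 - 1) * z0) (at z0)"
      unfolding D_def[abs_def] by (auto intro!: derivative_eq_intros)
    ultimately have "(H has_real_derivative h) (at z0)"
      unfolding H_def[abs_def]
      by (rule DERIV_cong[OF DERIV_divide]) (use D[of z0] in \<open>auto simp: h_def H_def field_simps\<close>)
    then have "(\<sigma> has_real_derivative (H z0 + \<beta> + z0 * h)) (at z0)"
      unfolding \<sigma>_def[abs_def] by (auto intro!: derivative_eq_intros)
    moreover have "H z0 + \<beta> + z0 * h = s'"
    proof -
      define m where "m = inverse (z0\<^sup>2 + 1)"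
      have m: "m * (z0\<^sup>2 + 1) - 1 = 0" using sq_plus_one_neq_0[of z0] by (simp add: m_def)
      have "2 * (z0\<^sup>2 + 1) * ((Y0 + \<beta>) * D z0
            + z0 * (2 * (2 * z0 * \<beta> - \<alpha>) - 2 * (b1 - 1) * z0 * Y0)) + Son'_fun b1 c x
          = 2 * c * D z0 * (m * (z0\<^sup>2 + 1) - 1)"
        unfolding \<alpha>\<beta> x Son'_fun_def D_def case_prod_conv divide_inverse m_def[symmetric]
        by (simp add: eval_nat_numeral field_simps)
      then have "2 * (z0\<^sup>2 + 1) * ((Y0 + \<beta>) * D z0 + z0 * (h * D z0)) = - Son'_fun b1 c x"
        unfolding m using D[of z0] by (simp add: h_def tY)
      then have "s' = (Y0 + \<beta> + z0 * h) * (2 * (z0\<^sup>2 + 1) * D z0) / (2 * (z0\<^sup>2 + 1) * D z0)"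
        unfolding s'_def by (simp add: algebra_simps)
      then show ?thesis using D[of z0] sq_plus_one_neq_0[of z0] tY by simp
    qed
    ultimately show ?thesis by simp
  qed
  have "x \<in> Son' a1 a2 a3 a4 b1 \<longleftrightarrow> critical_point_on (speed a1 a2 a3 a4 b1) K x"
    by (simp add: Son'_def K_def)
  also have "\<dots> \<longleftrightarrow> s' = 0"
  proof
    assume crit: "critical_point_on (speed a1 a2 a3 a4 b1) K x"
    define \<gamma> where "\<gamma> \<tau> = (T (z0 + \<tau>), z0 + \<tau>, H (z0 + \<tau>))" for \<tau>
    have "T differentiable at (z0 + 0)" "H differentiable at (z0 + 0)"
      unfolding T_def H_def using D[of z0] c
      by (auto simp: D_def sq_plus_one_neq_0 intro!: derivative_intros)
    then have "(\<lambda>\<tau>. T (z0 + \<tau>)) differentiable at 0" "(\<lambda>\<tau>. H (z0 + \<tau>)) differentiable at 0"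
      by (auto intro!: differentiable_chain_at[of "\<lambda>\<tau>. z0 + \<tau>", unfolded o_def] derivative_intros)
    then have "\<gamma> differentiable at 0"
      unfolding \<gamma>_def[abs_def] by (auto intro!: differentiable_Pair derivative_intros)
    then obtain w where "(\<gamma> has_vector_derivative w) (at 0)"
      using vector_derivative_works by blast
    moreover have "\<gamma> 0 = x" "\<And>\<tau>. \<gamma> \<tau> \<in> K" by (simp_all add: \<gamma>_def x tY K_iff)
    ultimately have "((\<lambda>\<tau>. speed a1 a2 a3 a4 b1 (\<gamma> \<tau>)) has_real_derivative 0) (at 0)"
      using crit unfolding critical_point_on_def by blast
    then have "((\<lambda>\<tau>. \<sigma> (\<tau> + z0)) has_real_derivative 0) (at 0)"
      using \<open>\<And>\<tau>. \<gamma> \<tau> \<in> K\<close> by (simp add: speed) (simp add: \<gamma>_def add.commute)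
    then have "(\<sigma> has_real_derivative 0) (at z0)" using DERIV_shift[of \<sigma> 0 0 z0] by simp
    with \<sigma>' show "s' = 0" by (rule DERIV_unique)
  next
    assume s': "s' = 0"
    show "critical_point_on (speed a1 a2 a3 a4 b1) K x"
      unfolding critical_point_on_def
    proof (intro conjI xK allI impI; elim conjE)
      fix \<gamma> w
      assume \<gamma>: "\<gamma> 0 = x" "\<forall>\<tau>. \<gamma> \<tau> \<in> K" "(\<gamma> has_vector_derivative w) (at 0)"
      have "((\<lambda>\<tau>. fst (snd (\<gamma> \<tau>))) has_vector_derivative fst (snd w)) (at 0)"
        using \<gamma>(3) by (auto simp: has_vector_derivative_def intro!: derivative_eq_intros)
      then have "((\<lambda>\<tau>. fst (snd (\<gamma> \<tau>))) has_real_derivative fst (snd w)) (at 0)"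
        by (simp add: has_real_derivative_iff_has_vector_derivative)
      then have "((\<lambda>\<tau>. \<sigma> (fst (snd (\<gamma> \<tau>)))) has_real_derivative s' * fst (snd w)) (at 0)"
        using DERIV_chain2[of \<sigma> s'] \<sigma>' \<gamma>(1) by (simp add: x)
      then show "((\<lambda>\<tau>. speed a1 a2 a3 a4 b1 (\<gamma> \<tau>)) has_real_derivative 0) (at 0)"
        using \<gamma>(2) s' by (simp add: speed)
    qed
  qed
  also have "\<dots> \<longleftrightarrow> x \<in> {x. Son'_fun b1 (a3 - a2) x = 0}"
    using D[of z0] sq_plus_one_neq_0[of z0] by (simp add: s'_def c_def)
  finally show "x \<in> Son' a1 a2 a3 a4 b1 \<longleftrightarrow> x \<in> {x. Son'_fun b1 (a3 - a2) x = 0}" .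
qed

theorem lemma2:
  fixes a1 a2 a3 a4 b1 :: real
  assumes "b1 > 1" and "a3 - a2 > 0"
  shows "tangent_surfaces (Tf a1 a2 a3 a4 b1) (char_surface a1 a2 a3 a4 b1) \<and>
         tangent_surfaces (Tf a1 a2 a3 a4 b1) (Son' a1 a2 a3 a4 b1)"
  using tangent_Tf_char[OF assms] tangent_Tf_Son'[OF assms]
    Tf_eq[of b1 a3 a2 a1 a4] char_surface_eq[of b1 a3 a2 a1 a4] Son'_eq[OF assms, of a1 a4] assms
  by simp

end
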